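(* Let $G=(V,E)$ be a finite, simple, connected AT-free graph. Then for every vertex $s \in V$ there is a linear vertex ordering $\tau = (s=v_1,\ldots,v_n)$ of $V$ that is simultaneously an AT-free order of $G$ and a BFS order of $G$ (starting in $s$).
   Context: An asteroidal triple of $G$ is an independent set of three vertices such that for any two of them there is a path between them containing no neighbour of the third; $G$ is AT-free if it has no asteroidal triple. A path $P$ avoids a vertex $v$ if $v$ has no neighbour on $P$. The domination betweenness $\mathcal{B}_D(G)$ is the set of triples $(x,y,z)$ of distinct vertices such that there is a chordless (induced) $x$-$y$-path that avoids $z$ and a chordless $y$-$z$-path that avoids $x$. An AT-free order of $G$ is a linear ordering $\tau$ of $V$ such that for every $(x,y,z) \in \mathcal{B}_D(G)$ we have $y \prec_\tau x$ or $y \prec_\tau z$. A BFS order starting in $s$ is an ordering of $V$ that can be produced by a breadth-first search started at $s$ (with some tie-breaking). *)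

theory Defs
  imports "Graph_Theory.Graph_Theory"
begin

text \<open>
  A finite simple graph is a \<^locale>\<open>pair_graph\<close>: finite, loop-free, and with a symmetric arc
  relation, an undirected edge \<open>uv\<close> being the pair of arcs \<open>(u, v)\<close>, \<open>(v, u)\<close>.
\<close>

definition path_between :: "'a pair_pre_digraph \<Rightarrow> 'a \<Rightarrow> 'a list \<Rightarrow> 'a \<Rightarrow> bool" where
  "path_between G x p y \<longleftrightarrow> vpath p (with_proj G) \<and> hd p = x \<and> last p = y"

definition chordless :: "'a pair_pre_digraph \<Rightarrow> 'a list \<Rightarrow> bool" where
  "chordless G p \<longleftrightarrow>
    (\<forall>i j. i < j \<and> j < length p \<and> (p ! i, p ! j) \<in> parcs G \<longrightarrow> j = Suc i)"

definition avoids :: "'a pair_pre_digraph \<Rightarrow> 'a list \<Rightarrow> 'a \<Rightarrow> bool" where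
  "avoids G p v \<longleftrightarrow> (\<forall>u \<in> set p. (v, u) \<notin> parcs G)"

definition independent_set :: "'a pair_pre_digraph \<Rightarrow> 'a set \<Rightarrow> bool" where
  "independent_set G A \<longleftrightarrow> A \<subseteq> pverts G \<and> (\<forall>u \<in> A. \<forall>v \<in> A. (u, v) \<notin> parcs G)"

definition asteroidal_triple :: "'a pair_pre_digraph \<Rightarrow> 'a set \<Rightarrow> bool" where
  "asteroidal_triple G A \<longleftrightarrow> independent_set G A \<and> card A = 3 \<and>
    (\<forall>a \<in> A. \<forall>b \<in> A. \<forall>c \<in> A. a \<noteq> b \<and> a \<noteq> c \<and> b \<noteq> c \<longrightarrow>
      (\<exists>p. path_between G a p b \<and> avoids G p c))"

definition AT_free :: "'a pair_pre_digraph \<Rightarrow> bool" where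
  "AT_free G \<longleftrightarrow> (\<nexists>A. asteroidal_triple G A)"

definition domination_betweenness :: "'a pair_pre_digraph \<Rightarrow> ('a \<times> 'a \<times> 'a) set" where
  "domination_betweenness G = {(x, y, z).
    x \<in> pverts G \<and> y \<in> pverts G \<and> z \<in> pverts G \<and> x \<noteq> y \<and> x \<noteq> z \<and> y \<noteq> z \<and>
    (\<exists>p. path_between G x p y \<and> chordless G p \<and> avoids G p z) \<and>
    (\<exists>q. path_between G y q z \<and> chordless G q \<and> avoids G q x)}"

definition linear_vertex_order :: "'a pair_pre_digraph \<Rightarrow> 'a list \<Rightarrow> bool" where
  "linear_vertex_order G \<tau> \<longleftrightarrow> distinct \<tau> \<and> set \<tau> = pverts G"

definition precedes :: "'a list \<Rightarrow> 'a \<Rightarrow> 'a \<Rightarrow> bool" where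
  "precedes \<tau> u v \<longleftrightarrow> (\<exists>i j. i < j \<and> j < length \<tau> \<and> \<tau> ! i = u \<and> \<tau> ! j = v)"

definition AT_free_order :: "'a pair_pre_digraph \<Rightarrow> 'a list \<Rightarrow> bool" where
  "AT_free_order G \<tau> \<longleftrightarrow> linear_vertex_order G \<tau> \<and>
    (\<forall>(x, y, z) \<in> domination_betweenness G. precedes \<tau> y x \<or> precedes \<tau> y z)"

text \<open>
  \<open>bfs_state G s \<sigma> Q\<close>: a breadth-first search of \<open>G\<close> started at \<open>s\<close> can reach the state in which the
  vertices of \<open>\<sigma>\<close> have been visited, in this order, and \<open>Q\<close> is the queue.  Visiting the front \<open>v\<close>
  of the queue appends the not yet discovered neighbours of \<open>v\<close> to its end; the list \<open>ws\<close> is an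
  arbitrary enumeration of them, which is the tie-breaking.
\<close>

inductive bfs_state :: "'a pair_pre_digraph \<Rightarrow> 'a \<Rightarrow> 'a list \<Rightarrow> 'a list \<Rightarrow> bool"
  for G :: "'a pair_pre_digraph" and s :: 'a where
  init: "bfs_state G s [] [s]"
| visit: "\<lbrakk>bfs_state G s \<sigma> (v # Q); distinct ws;
           set ws = {w. (v, w) \<in> parcs G} - set (\<sigma> @ v # Q)\<rbrakk>
          \<Longrightarrow> bfs_state G s (\<sigma> @ [v]) (Q @ ws)"

definition BFS_order :: "'a pair_pre_digraph \<Rightarrow> 'a \<Rightarrow> 'a list \<Rightarrow> bool" where
  "BFS_order G s \<tau> \<longleftrightarrow> linear_vertex_order G \<tau> \<and> bfs_state G s \<tau> []"

end

theory Submission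
  imports Defs
begin

text \<open>
  Write \<open>a ~ b | c\<close> if \<open>a\<close> and \<open>b\<close> lie in the same component of \<open>G - N[c]\<close>.  Then
  \<open>(x, y, z)\<close> is in the domination betweenness iff \<open>x ~ y | z\<close> and \<open>y ~ z | x\<close>, and AT-freeness
  says that then \<open>x ~ z | y\<close> fails.

  Fix a vertex \<open>a\<close> and a finite set \<open>U\<close>, and let \<open>D\<close> consist of the \<open>x \<in> U\<close> for which the component
  of \<open>G - N[x]\<close> containing \<open>a\<close> is one fixed component \<open>C\<close> of maximal size.  If \<open>x \<in> D\<close> is between
  \<open>u\<close> and \<open>v\<close>, then one of them, say \<open>u\<close>, is outside \<open>C\<close>, so \<open>C\<close> is contained in the component of \<open>a\<close>
  in \<open>G - N[u]\<close>; if \<open>u \<in> U\<close>, then maximality forces equality, hence \<open>v\<close> is outside \<open>C\<close> as well, and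
  if also \<open>v \<in> U\<close> then \<open>u, v \<in> D\<close>.  With \<open>a\<close> taken from \<open>U\<close>, induction shows that every nonempty
  finite set has an element that is not between two others.

  When breadth-first search visits \<open>p\<close>, let \<open>U\<close> be the new neighbours of \<open>p\<close> and \<open>A\<close> the vertices
  discovered before.  A vertex of \<open>U\<close> has no neighbour among the vertices visited before \<open>p\<close>, and
  these connect all its non-neighbours in \<open>A\<close>.  With \<open>a \<in> A\<close> the same argument shows that some
  element of \<open>U\<close> is not between two vertices of \<open>A \<union> U\<close>; placing it last and iterating gives the
  order in which \<open>p\<close> enqueues \<open>U\<close>.
\<close>

section \<open>Components of the complement of a closed neighbourhood\<close>

definition remote :: "'a pair_pre_digraph \<Rightarrow> 'a \<Rightarrow> 'a \<Rightarrow> bool" where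
  "remote G c v \<longleftrightarrow> c \<in> pverts G \<and> v \<in> pverts G \<and> v \<noteq> c \<and> (c, v) \<notin> parcs G"

text \<open>This is a ~ b | c of the overview, with the removed \<open>c\<close> as first
  argument.\<close>

inductive linked :: "'a pair_pre_digraph \<Rightarrow> 'a \<Rightarrow> 'a \<Rightarrow> 'a \<Rightarrow> bool"
  for G :: "'a pair_pre_digraph" and c a :: 'a where
  refl: "remote G c a \<Longrightarrow> linked G c a a"
| step: "\<lbrakk>linked G c a b; (b, d) \<in> parcs G; remote G c d\<rbrakk> \<Longrightarrow> linked G c a d"

definition between :: "'a pair_pre_digraph \<Rightarrow> 'a \<Rightarrow> 'a \<Rightarrow> 'a \<Rightarrow> bool" where
  "between G x y z \<longleftrightarrow> linked G z x y \<and> linked G x y z"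

lemma linked_remote:
  assumes "linked G c a b"
  shows "remote G c a" "remote G c b"
  using assms by (induction rule: linked.induct) auto

lemma linked_trans:
  assumes "linked G c b d" "linked G c a b"
  shows "linked G c a d"
  using assms by (induction rule: linked.induct) (simp, metis linked.step)

context pair_graph
begin

lemma parcs_sym: "(u, v) \<in> parcs G \<Longrightarrow> (v, u) \<in> parcs G"
  using graph_symmetric by simp

lemma remote_sym: "remote G u v \<Longrightarrow> remote G v u"
  unfolding remote_def using parcs_sym by blast

lemma linked_arc:
  "\<lbrakk>(a, b) \<in> parcs G; remote G c a; remote G c b\<rbrakk> \<Longrightarrow> linked G c a b"
  by (blast intro: linked.intros)

lemma linked_sym:
  assumes "linked G c a b"
  shows "linked G c b a"
  using assms
proof (induction rule: linked.induct)
  case refl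
  then show ?case by (rule linked.refl)
next
  case (step b d)
  then have "linked G c d b"
    using linked_arc[OF parcs_sym[OF step.hyps(2)]] linked_remote(2)[OF step.hyps(1)] by blast
  with step.IH show ?case
    by (rule linked_trans)
qed

text \<open>A walk in G - N[x] outside the component of \<open>u\<close> misses N[u]: a vertex of
  N[u] on it would join it to \<open>u\<close> within G - N[x].\<close>

lemma linked_transfer:
  assumes "linked G x b d" "remote G x u" "\<not> linked G x u b"
  shows "linked G u b d"
  using assms
proof (induction rule: linked.induct)
  case refl
  have "u \<noteq> b"
    using refl linked.refl by metis
  moreover have "(u, b) \<notin> parcs G"
    using refl linked_arc[of u b x] by blast
  ultimately show ?case
    using refl unfolding remote_def by (auto intro!: linked.refl simp: remote_def)
next
  case (step d e)
  have bd: "linked G x b e"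
    using step.hyps by (rule linked.step)
  then have "u \<noteq> e"
    using step.prems linked_sym[OF bd] by blast
  moreover have "(u, e) \<notin> parcs G"
    using step.prems step.hyps(3) linked_arc[of u e x] linked_trans[OF linked_sym[OF bd]] by blast
  ultimately have "remote G u e"
    using step.hyps step.prems unfolding remote_def by auto
  then show ?case
    using step linked.step[of G u b d e] by blast
qed

lemma between_sym: "between G x y z \<Longrightarrow> between G z y x"
  unfolding between_def by (auto intro: linked_sym)

lemma between_remote:
  assumes "between G x y z"
  shows "remote G y x" "remote G y z" "remote G x z"
proof -
  have "linked G z x y" "linked G x y z"
    using assms unfolding between_def by auto
  from this[THEN linked_remote(1)] this[THEN linked_remote(2)]
  show "remote G y x" "remote G y z" "remote G x z"
    by (auto intro: remote_sym)
qed

section \<open>Avoiding paths versus components\<close>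

lemma path_imp_linked:
  assumes "path_between G a p b" "avoids G p c" "a \<noteq> c" "c \<in> pverts G"
  shows "linked G c a b"
proof -
  have "vwalk p (with_proj G)"
    using assms unfolding path_between_def by blast
  then have "avoids G p c \<Longrightarrow> hd p \<noteq> c \<Longrightarrow> linked G c (hd p) (last p)"
  proof (induction rule: vwalk_induct)
    case (Base u)
    then show ?case
      using assms(4) by (auto simp: avoids_def remote_def intro!: linked.refl)
  next
    case (Cons u v es)
    then have uv: "(u, v) \<in> parcs G"
      by simp
    \<comment> \<open>Avoiding \<open>c\<close> does not by itself keep \<open>c\<close> off the
      walk, but \<open>c\<close> could only be entered from a neighbour of \<open>c\<close>, here
      \<open>u\<close>.\<close>
    then have "v \<noteq> c"
      using Cons.prems parcs_sym unfolding avoids_def by auto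
    then have "linked G c v (last (v # es))"
      using Cons unfolding avoids_def by simp
    moreover have "remote G c u"
      using Cons.prems assms(4) uv wellformed'(1) by (auto simp: avoids_def remote_def)
    ultimately have "linked G c u (last (v # es))"
      using uv linked_arc[of u v c] linked_remote(1)[of G c v] linked_trans[of G c v _ u] by blast
    then show ?case by simp
  qed
  then show ?thesis
    using assms unfolding path_between_def by blast
qed

lemma linked_imp_path:
  assumes "linked G c a b"
  shows "\<exists>p. path_between G b p a \<and> avoids G p c"
proof -
  have "\<exists>p. vwalk p (with_proj G) \<and> hd p = b \<and> last p = a \<and> avoids G p c"
    using assms
  proof (induction rule: linked.induct)
    case refl
    then show ?case
      by (intro exI[of _ "[a]"]) (auto simp: vwalk_def remote_def avoids_def)
  next
    case (step b d)
    then obtain p where p: "vwalk p (with_proj G)" "hd p = b" "last p = a" "avoids G p c"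
      by blast
    have "vwalk (d # p) (with_proj G)"
      using p step.hyps parcs_sym by (intro vwalk_consI) (auto simp: remote_def)
    then show ?case
      using p step.hyps
      by (intro exI[of _ "d # p"]) (auto simp: vwalk_def remote_def avoids_def)
  qed
  then obtain p where "vwalk p (with_proj G)" "hd p = b" "last p = a" "avoids G p c"
    by blast
  then show ?thesis
    unfolding path_between_def avoids_def
    by (intro exI[of _ "vwalk_to_vpath p"])
      (auto simp: vwalk_to_vpath_hd vwalk_to_vpath_last vwalk_to_vpath_vpath
        dest: vwalk_to_vpath_subset)
qed

lemma domination_betweenness_imp_between:
  "(x, y, z) \<in> domination_betweenness G \<Longrightarrow> between G x y z"
  unfolding domination_betweenness_def between_def by (auto intro: path_imp_linked)

lemma AT_free_not_linked:
  assumes "AT_free G" "between G x y z"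
  shows "\<not> linked G y x z"
proof
  assume xz: "linked G y x z"
  note r = between_remote[OF assms(2)]
  note r' = r[THEN remote_sym]
  note l = assms(2)[unfolded between_def, THEN conjunct1]
    assms(2)[unfolded between_def, THEN conjunct2] xz
  \<comment> \<open>Both orientations of the three links cover all ordered choices of two ends and
    an avoided vertex.\<close>
  note paths = l[THEN linked_imp_path] l[THEN linked_sym, THEN linked_imp_path]
  have "(v, v) \<notin> parcs G" for v
    using pair_no_loops by fastforce
  then have "asteroidal_triple G {x, y, z}"
    unfolding asteroidal_triple_def independent_set_def
    using r r' paths by (auto simp: remote_def)
  with assms(1) show False
    unfolding AT_free_def by blast
qed

end

section \<open>Extreme vertices\<close>

locale AT_free_pair_graph = pair_graph +
  assumes AT_free: "AT_free G"
begin

lemma maximal_component_transfer: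
  assumes x: "remote G x a"
    and max: "\<And>y. y \<in> U \<Longrightarrow> remote G y a \<Longrightarrow>
      card {w. linked G y a w} \<le> card {w. linked G x a w}"
    and btw: "between G u x v"
    and u: "u \<in> U" "\<not> linked G x a u"
  shows "remote G u a \<and> {w. linked G u a w} = {w. linked G x a w} \<and> \<not> linked G x a v"
proof -
  have "remote G x u"
    using between_remote[OF btw] by blast
  then have sub: "linked G u a w" if "linked G x a w" for w
    using linked_transfer[OF that] u(2) linked_sym[of x u a] by blast
  have ua: "remote G u a"
    by (rule linked_remote(1)[OF sub[OF linked.refl[OF x]]])
  have "finite {w. linked G u a w}"
    by (rule finite_subset[OF _ pair_finite_verts]) (auto dest: linked_remote simp: remote_def)
  then have eq: "{w. linked G u a w} = {w. linked G x a w}"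
    using sub max[OF u(1) ua] by (intro sym[OF card_seteq]) auto
  have "\<not> linked G x a v"
  \<comment> \<open>Otherwise x ~ v | u puts \<open>x\<close> into the component of \<open>a\<close>
    in G - N[u]. That is also its component in G - N[x], which cannot contain
    \<open>x\<close>.\<close>
  proof
    assume "linked G x a v"
    then have "linked G u a x"
      using sub[of v] btw linked_trans[of G u v x a] linked_sym[of u x v] unfolding between_def
      by blast
    then have "linked G x a x"
      using eq by blast
    then show False
      using linked_remote(2)[of G x a x] unfolding remote_def by blast
  qed
  with ua eq show ?thesis by blast
qed

text \<open>The alternative "in \<open>U\<close> or linked to \<open>a\<close>" makes the class
  serve twice: once with all ends in \<open>U\<close>, once with further ends that are known to lie
  in the common component.\<close>

lemma maximal_component_class:
  assumes "finite U" "y \<in> U" "remote G y a"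
  obtains D where "D \<noteq> {}" "D \<subseteq> U" "\<forall>x \<in> D. remote G x a"
    and "\<forall>x \<in> D. \<forall>u v. between G u x v \<longrightarrow> u \<in> U \<or> linked G x a u \<longrightarrow>
        v \<in> U \<or> linked G x a v \<longrightarrow> u \<in> D \<and> v \<in> D"
proof -
  define C where "C x = {w. linked G x a w}" for x
  have fin: "finite {x \<in> U. remote G x a}" and "{x \<in> U. remote G x a} \<noteq> {}"
    using assms by auto
  then obtain x0 where x0: "x0 \<in> U" "remote G x0 a"
      and max: "\<And>x. x \<in> U \<Longrightarrow> remote G x a \<Longrightarrow> card (C x) \<le> card (C x0)"
    using obtains_MAX[OF fin, of "\<lambda>x. card (C x)"]
    by (metis (mono_tags, lifting) Max_ge finite_imageI imageI mem_Collect_eq)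
  define D where "D = {x \<in> U. remote G x a \<and> C x = C x0}"
  have half: "u \<in> D \<and> v \<in> D"
    if x: "x \<in> D" and btw: "between G u x v"
      and u: "u \<in> U" "\<not> linked G x a u" and v: "v \<in> U \<or> linked G x a v" for x u v
  proof -
    have xa: "remote G x a" and Cx: "C x = C x0"
      using x unfolding D_def by auto
    note transfer = maximal_component_transfer[OF xa, of U,
        folded C_def, unfolded Cx, OF max]
    have 1: "remote G u a \<and> C u = C x0 \<and> \<not> linked G x a v"
      using transfer[OF _ _ btw u] by blast
    \<comment> \<open>Now \<open>v\<close> is outside the component, hence in \<open>U\<close>, and
      the transfer applies with \<open>u\<close> and \<open>v\<close> exchanged.\<close>
    moreover have "remote G v a \<and> C v = C x0"
      using transfer[OF _ _ between_sym[OF btw]] 1 v by blast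
    ultimately show ?thesis
      using u v unfolding D_def by blast
  qed
  show ?thesis
  proof (rule that[of D])
    show "D \<noteq> {}" "D \<subseteq> U" "\<forall>x \<in> D. remote G x a"
      using x0 unfolding D_def by auto
    show "\<forall>x \<in> D. \<forall>u v. between G u x v \<longrightarrow> u \<in> U \<or> linked G x a u \<longrightarrow>
        v \<in> U \<or> linked G x a v \<longrightarrow> u \<in> D \<and> v \<in> D"
    proof (intro ballI allI impI)
      fix x u v
      assume x: "x \<in> D" and btw: "between G u x v"
        and u: "u \<in> U \<or> linked G x a u" and v: "v \<in> U \<or> linked G x a v"
      \<comment> \<open>Otherwise u ~ v | x would complete an asteroidal triple.\<close>
      have "\<not> (linked G x a u \<and> linked G x a v)"
        using AT_free_not_linked[OF AT_free btw] linked_sym[of x a u] linked_trans[of G x a v u]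
        by blast
      then show "u \<in> D \<and> v \<in> D"
        using half[OF x btw] half[OF x between_sym[OF btw]] u v by blast
    qed
  qed
qed

lemma ex_extreme:
  assumes "finite S" "S \<noteq> {}"
  shows "\<exists>x \<in> S. \<forall>u \<in> S. \<forall>v \<in> S. \<not> between G u x v"
  using assms
proof (induction S rule: finite_psubset_induct)
  case (psubset S)
  show ?case
  proof (cases "\<exists>a \<in> S. \<exists>y \<in> S. remote G y a")
    case True
    then obtain a y where a: "a \<in> S" and y: "y \<in> S" "remote G y a"
      by blast
    obtain D where D: "D \<noteq> {}" "D \<subseteq> S" "\<forall>x \<in> D. remote G x a"
      "\<forall>x \<in> D. \<forall>u v. between G u x v \<longrightarrow> u \<in> S \<or> linked G x a u \<longrightarrow>
        v \<in> S \<or> linked G x a v \<longrightarrow> u \<in> D \<and> v \<in> D"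
      by (rule maximal_component_class[OF psubset.hyps y], rule that)
    \<comment> \<open>No vertex is remote from itself; this makes \<open>D\<close> a proper subset,
      so the induction applies.\<close>
    have "a \<notin> D"
      using D(3) unfolding remote_def by blast
    then have "D \<subset> S"
      using D(2) a by blast
    from psubset.IH[OF this D(1)] obtain x where x: "x \<in> D" "\<forall>u \<in> D. \<forall>v \<in> D. \<not> between G u x v"
      by blast
    have "\<not> between G u x v" if "u \<in> S" "v \<in> S" for u v
      using D(4) x that by blast
    then show ?thesis
      using x(1) D(2) by blast
  next
    case False
    then show ?thesis
      using psubset.prems by (meson between_remote(1) ex_in_conv)
  qed
qed

text \<open>By \<open>conn\<close>, the vertices of \<open>A\<close> remote from a member x of
  \<open>D\<close> lie in the component of \<open>a\<close> in G - N[x]. So the ends of a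
  betweenness around x fall into \<open>D\<close>, and an extreme element of \<open>D\<close>
  suffices.\<close>

lemma ex_extreme_relative:
  assumes "finite U" "U \<noteq> {}"
    and conn: "\<And>y a b. \<lbrakk>y \<in> U; a \<in> A; b \<in> A; remote G y a; remote G y b\<rbrakk> \<Longrightarrow> linked G y a b"
  shows "\<exists>x \<in> U. \<forall>u \<in> A \<union> U. \<forall>v \<in> A \<union> U. \<not> between G u x v"
proof (cases "\<exists>a \<in> A. \<exists>y \<in> U. remote G y a")
  case True
  then obtain a y where a: "a \<in> A" and y: "y \<in> U" "remote G y a"
    by blast
  obtain D where D: "D \<noteq> {}" "D \<subseteq> U" "\<forall>x \<in> D. remote G x a"
    "\<forall>x \<in> D. \<forall>u v. between G u x v \<longrightarrow> u \<in> U \<or> linked G x a u \<longrightarrow>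
        v \<in> U \<or> linked G x a v \<longrightarrow> u \<in> D \<and> v \<in> D"
    by (rule maximal_component_class[OF assms(1) y], rule that)
  obtain x where x: "x \<in> D" "\<forall>u \<in> D. \<forall>v \<in> D. \<not> between G u x v"
    using ex_extreme[of D] D(1,2) assms(1) finite_subset by blast
  have "\<not> between G u x v" if uv: "u \<in> A \<union> U" "v \<in> A \<union> U" for u v
  proof
    assume btw: "between G u x v"
    have "w \<in> U \<or> linked G x a w" if "w \<in> A \<union> U" "remote G x w" for w
      using that conn[of x a w] x(1) D(2,3) a by blast
    then have "u \<in> D \<and> v \<in> D"
      using D(4) x(1) btw uv between_remote(1,2)[OF btw] by blast
    then show False
      using x(2) btw by blast
  qed
  then show ?thesis
    using x(1) D(2) by blast
next
  \<comment> \<open>Ends are remote from the middle vertex, so here they cannot lie in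
    \<open>A\<close>.\<close>
  case False
  then show ?thesis
    using ex_extreme[OF assms(1,2)] by (metis Un_iff between_remote(1,2))
qed

section \<open>Breadth-first search with extreme vertices last\<close>

definition betweenness_free :: "'a list \<Rightarrow> bool" where
  "betweenness_free xs \<longleftrightarrow>
    (\<forall>j < length xs. \<forall>i < j. \<forall>k < j. \<not> between G (xs ! i) (xs ! j) (xs ! k))"

lemma betweenness_free_snoc:
  "betweenness_free (xs @ [y]) \<longleftrightarrow>
    betweenness_free xs \<and> (\<forall>x \<in> set xs. \<forall>z \<in> set xs. \<not> between G x y z)"
  unfolding betweenness_free_def
  by (auto simp: less_Suc_eq nth_append all_set_conv_all_nth)

lemma betweenness_free_extend:
  assumes "finite U" "betweenness_free xs"
    and "\<And>y a b. \<lbrakk>y \<in> U; a \<in> set xs; b \<in> set xs; remote G y a; remote G y b\<rbrakk>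
      \<Longrightarrow> linked G y a b"
  shows "\<exists>ws. distinct ws \<and> set ws = U \<and> betweenness_free (xs @ ws)"
  using assms
proof (induction U rule: finite_psubset_induct)
  case (psubset U)
  show ?case
  proof (cases "U = {}")
    case True
    then show ?thesis
      using psubset.prems by auto
  next
    case False
    then obtain x where x: "x \<in> U"
      "\<forall>u \<in> set xs \<union> U. \<forall>v \<in> set xs \<union> U. \<not> between G u x v"
      using ex_extreme_relative[OF psubset.hyps, of "set xs"] psubset.prems(2) by blast
    then obtain ws where ws: "distinct ws" "set ws = U - {x}" "betweenness_free (xs @ ws)"
      using psubset.IH[of "U - {x}"] psubset.prems by blast
    have "betweenness_free ((xs @ ws) @ [x])"
      unfolding betweenness_free_snoc using ws x by auto
    then show ?thesis
      using ws x(1) by (intro exI[of _ "ws @ [x]"]) auto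
  qed
qed

section \<open>Discovered vertices during the search\<close>

lemma bfs_state_invariant:
  assumes "bfs_state G s \<sigma> Q" "s \<in> pverts G"
  shows "distinct (\<sigma> @ Q) \<and> set (\<sigma> @ Q) \<subseteq> pverts G \<and> hd (\<sigma> @ Q) = s \<and> \<sigma> @ Q \<noteq> [] \<and>
    (\<sigma> = [] \<longrightarrow> Q = [s]) \<and> (\<forall>v \<in> set \<sigma>. \<forall>w. (v, w) \<in> parcs G \<longrightarrow> w \<in> set (\<sigma> @ Q))"
  using assms
proof (induction rule: bfs_state.induct)
  case init
  then show ?case by simp
next
  case (visit \<sigma> v Q ws)
  have "hd (\<sigma> @ v # Q @ ws) = hd (\<sigma> @ v # Q)"
    by (cases \<sigma>) auto
  with visit show ?case
    by (auto dest: wellformed'(2))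
qed

text \<open>Each discovered vertex other than \<open>s\<close> was found from a visited one.
  Following these parents back to \<open>s\<close> stays in G - N[y].\<close>

lemma bfs_state_linked:
  assumes "bfs_state G s \<sigma> Q" "s \<in> pverts G" "\<sigma> \<noteq> []"
    and "\<And>v. v \<in> set \<sigma> \<Longrightarrow> remote G y v"
    and "w \<in> set (\<sigma> @ Q)" "remote G y w"
  shows "linked G y s w"
  using assms
proof (induction arbitrary: w rule: bfs_state.induct)
  case init
  then show ?case by simp
next
  case (visit \<sigma> v Q ws)
  have "remote G y v"
    using visit.prems by simp
  have old: "linked G y s u" if "u \<in> set (\<sigma> @ v # Q)" "remote G y u" for u
  proof (cases "\<sigma> = []")
    case True
    then have "u = s"
      using bfs_state_invariant[OF visit.hyps(1) visit.prems(1)] that by auto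
    then show ?thesis
      using that(2) by (auto intro: linked.refl)
  next
    case False
    then show ?thesis
      using visit that by auto
  qed
  show ?case
  proof (cases "w \<in> set (\<sigma> @ v # Q)")
    case True
    then show ?thesis
      using old visit.prems by blast
  next
    case False
    then have "(v, w) \<in> parcs G"
      using visit by auto
    then show ?thesis
      using old[of v] \<open>remote G y v\<close> visit.prems linked.step[of G y s v w] by simp
  qed
qed

text \<open>The invariant concerns \<open>\<sigma> @ Q\<close>, the order of discovery, which a
  visit changes only by appending the new neighbours.\<close>

lemma ex_betweenness_free_bfs_state:
  assumes s: "s \<in> pverts G"
  shows "\<exists>\<sigma> Q. bfs_state G s \<sigma> Q \<and> betweenness_free (\<sigma> @ Q) \<and> (Q = [] \<or> length \<sigma> = n)"
proof (induction n)
  case 0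
  have "betweenness_free [s]"
    unfolding betweenness_free_def by simp
  then show ?case
    using bfs_state.init by fastforce
next
  case (Suc n)
  then obtain \<sigma> Q where bfs: "bfs_state G s \<sigma> Q" and free: "betweenness_free (\<sigma> @ Q)"
    and len: "Q = [] \<or> length \<sigma> = n"
    by blast
  show ?case
  proof (cases Q)
    case Nil
    then show ?thesis
      using bfs free by blast
  next
    case (Cons p Q')
    define U where "U = {w. (p, w) \<in> parcs G} - set (\<sigma> @ p # Q')"
    have inv: "set (\<sigma> @ p # Q') \<subseteq> pverts G" "\<sigma> = [] \<longrightarrow> Q' = []"
      "\<And>v w. v \<in> set \<sigma> \<Longrightarrow> (v, w) \<in> parcs G \<Longrightarrow> w \<in> set (\<sigma> @ p # Q')"
      using bfs_state_invariant[OF bfs s] Cons by auto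
    have "U \<subseteq> pverts G"
      unfolding U_def using wellformed'(2) by blast
    then have fin: "finite U"
      using pair_finite_verts finite_subset by blast
    have conn: "linked G y a b"
      if y: "y \<in> U" and ab: "a \<in> set (\<sigma> @ p # Q')" "b \<in> set (\<sigma> @ p # Q')"
        "remote G y a" "remote G y b" for y a b
    \<comment> \<open>At the first visit only \<open>p\<close> is discovered, and it is adjacent to
      \<open>y\<close>, hence not remote.\<close>
    proof (cases "\<sigma> = []")
      case True
      then have "a = p"
        using ab inv(2) by simp
      then show ?thesis
        using ab(3) y parcs_sym unfolding U_def remote_def by blast
    next
      case False
      \<comment> \<open>A visited neighbour of \<open>y\<close> would already have led to the
        discovery of \<open>y\<close>.\<close>
      have "remote G y v" if "v \<in> set \<sigma>" for v
        using that y inv \<open>U \<subseteq> pverts G\<close> parcs_sym[of y v]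
        unfolding remote_def U_def by auto
      then have "linked G y s a" "linked G y s b"
        using bfs_state_linked[OF bfs s False] ab Cons by auto
      then show ?thesis
        using linked_sym[of y s a] linked_trans[of G y s b a] by blast
    qed
    obtain ws where ws: "distinct ws" "set ws = U" "betweenness_free ((\<sigma> @ p # Q') @ ws)"
      using betweenness_free_extend[OF fin free[unfolded Cons] conn] by blast
    have "bfs_state G s (\<sigma> @ [p]) (Q' @ ws)"
      using bfs ws(1,2) unfolding Cons U_def by (rule bfs_state.visit)
    moreover have "length (\<sigma> @ [p]) = Suc n"
      using len Cons by simp
    ultimately show ?thesis
      using ws(3) by (intro exI[of _ "\<sigma> @ [p]"] exI[of _ "Q' @ ws"]) simp
  qed
qed

lemma ex_betweenness_free_bfs:
  assumes s: "s \<in> pverts G"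
  shows "\<exists>\<tau>. bfs_state G s \<tau> [] \<and> betweenness_free \<tau>"
proof -
  \<comment> \<open>The count exceeds the number of vertices, which forces the queue to be
    empty.\<close>
  obtain \<sigma> Q where bfs: "bfs_state G s \<sigma> Q" and free: "betweenness_free (\<sigma> @ Q)"
    and len: "Q = [] \<or> length \<sigma> = Suc (card (pverts G))"
    using ex_betweenness_free_bfs_state[OF s] by blast
  have "distinct \<sigma>" "set \<sigma> \<subseteq> pverts G"
    using bfs_state_invariant[OF bfs s] by auto
  then have "length \<sigma> \<le> card (pverts G)"
    using card_mono[OF pair_finite_verts] distinct_card by metis
  with bfs free len show ?thesis
    by auto
qed

lemma betweenness_free_imp_AT_free_order:
  assumes "linear_vertex_order G \<tau>" "betweenness_free \<tau>"
  shows "AT_free_order G \<tau>"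
proof -
  have "precedes \<tau> y x \<or> precedes \<tau> y z" if "(x, y, z) \<in> domination_betweenness G" for x y z
  proof -
    have "x \<in> set \<tau>" "y \<in> set \<tau>" "z \<in> set \<tau>" "x \<noteq> y" "y \<noteq> z"
      using that assms(1) unfolding domination_betweenness_def linear_vertex_order_def by auto
    then obtain i j k where ijk: "i < length \<tau>" "j < length \<tau>" "k < length \<tau>"
      "\<tau> ! i = x" "\<tau> ! j = y" "\<tau> ! k = z" "i \<noteq> j" "k \<noteq> j"
      by (metis in_set_conv_nth)
    then have "\<not> (i < j \<and> k < j)"
      using assms(2) domination_betweenness_imp_between[OF that] unfolding betweenness_free_def
      by blast
    then have "j < i \<or> j < k"
      using ijk by linarith
    then show ?thesis
      unfolding precedes_def using ijk by blast
  qed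
  then show ?thesis
    unfolding AT_free_order_def using assms(1) by blast
qed

end

lemma (in pair_graph) connected_closed_set:
  assumes "connected (with_proj G)" "s \<in> S" "s \<in> pverts G"
    and closed: "\<And>v w. v \<in> S \<Longrightarrow> (v, w) \<in> parcs G \<Longrightarrow> w \<in> S"
  shows "pverts G \<subseteq> S"
proof
  fix v assume v: "v \<in> pverts G"
  have "strongly_connected (with_proj G)"
    using symmetric_connected_imp_strongly_connected[OF pair_sym_arcs assms(1)] .
  then have "s \<rightarrow>\<^sup>*\<^bsub>with_proj G\<^esub> v"
    using assms(3) v by auto
  then show "v \<in> S"
    using assms(2) closed by (induction rule: reachable_induct) auto
qed

theorem theorem2:
  fixes G :: "'a pair_pre_digraph"
  assumes "pair_graph G"
    and "connected (with_proj G)"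
    and "AT_free G"
  shows "\<forall>s \<in> pverts G. \<exists>\<tau>. linear_vertex_order G \<tau> \<and> hd \<tau> = s \<and>
           AT_free_order G \<tau> \<and> BFS_order G s \<tau>"
proof
  fix s assume s: "s \<in> pverts G"
  interpret AT_free_pair_graph G
    using assms by (intro AT_free_pair_graph.intro AT_free_pair_graph_axioms.intro)
  obtain \<tau> where bfs: "bfs_state G s \<tau> []" and free: "betweenness_free \<tau>"
    using ex_betweenness_free_bfs[OF s] by blast
  note inv = bfs_state_invariant[OF bfs s]
  have "hd \<tau> = s" "s \<in> set \<tau>"
    using inv hd_in_set[of \<tau>] by auto
  \<comment> \<open>With an empty queue, the invariant says that the visited set is closed under
    adjacency.\<close>
  then have "pverts G \<subseteq> set \<tau>"
    using connected_closed_set[OF assms(2) _ s, of "set \<tau>"] inv by auto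
  then have lin: "linear_vertex_order G \<tau>"
    using inv unfolding linear_vertex_order_def by auto
  then show "\<exists>\<tau>. linear_vertex_order G \<tau> \<and> hd \<tau> = s \<and> AT_free_order G \<tau> \<and> BFS_order G s \<tau>"
    using \<open>hd \<tau> = s\<close> betweenness_free_imp_AT_free_order[OF lin free] bfs
    unfolding BFS_order_def by blast
qed

end
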